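(* For $\mathbf d\in\mathbb Z_{\ge0}^l$, $\mathbf b\in\mathbb N^s$, $n\in\mathbb N$ and any $1\le j\le s$, \[ \sum_{\mathbf 0\le\mathbf r\le\mathbf d}(-1)^{|\mathbf d-\mathbf r|}\binom{\mathbf d}{\mathbf r}\sum_{\substack{\mathbf a\in\mathcal C^s(n+|\mathbf r|)\\ \mathrm{ind}_n(\mathbf a)=j}}\binom{\mathbf a-\mathbf 1}{\mathbf b-\mathbf 1}=\begin{cases}\binom{n-1}{|\mathbf b|-|\mathbf d|-1}, & j=\mathrm{ind}_{|\mathbf b|-|\mathbf d|}(\mathbf b),\\ 0,&\text{otherwise.}\end{cases} \]
   Context: $\mathbb N=\{1,2,\dots\}$. For tuples $|\cdot|$ is the sum of entries, $\mathbf 1=(1,\dots,1)$, $\mathbf r\le\mathbf d$ componentwise with $\mathbf r\in\mathbb Z_{\ge0}^l$, and $\binom{\mathbf d}{\mathbf r}=\prod_i\binom{d_i}{r_i}$, $\binom{\mathbf a-\mathbf 1}{\mathbf b-\mathbf 1}=\prod_i\binom{a_i-1}{b_i-1}$; binomial coefficients $\binom{m}{k}$ vanish for $k<0$. $\mathcal C^s(m)=\{\mathbf a\in\mathbb N^s:|\mathbf a|=m\}$. For an integer $t$ and $\mathbf a=(a_1,\dots,a_s)$, $\mathrm{ind}_t(\mathbf a)=\min\{j:a_1+\dots+a_j\ge t\}$, and $\mathrm{ind}_t(\mathbf a)=0$ if $\mathbf a=\emptyset$ or $t>|\mathbf a|$. *)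

theory Defs
  imports Main
begin

(* Tuples are lists; the 1-based entry a_i is a ! (i - 1). *)

definition compositions :: "nat \<Rightarrow> nat \<Rightarrow> nat list set" where
  "compositions s m = {a. length a = s \<and> (\<forall>x\<in>set a. 1 \<le> x) \<and> sum_list a = m}"

definition tuples_below :: "nat list \<Rightarrow> nat list set" where
  "tuples_below d = {r. list_all2 (\<le>) r d}"

definition tuple_binom :: "nat list \<Rightarrow> nat list \<Rightarrow> nat" where
  "tuple_binom d r = (\<Prod>i<length d. (d ! i) choose (r ! i))"

(* Only used for tuples with positive entries, where the subtraction does not truncate. *)
definition tuple_pred :: "nat list \<Rightarrow> nat list" where
  "tuple_pred a = map (\<lambda>x. x - 1) a"

definition binom_int :: "nat \<Rightarrow> int \<Rightarrow> int" where
  "binom_int m k = (if k < 0 then 0 else int (m choose nat k))"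

(* The minimum is over the positions j = 1, ..., length a.  Hence for t \<le> 0 and nonempty a
   the index is 1. *)
definition ind :: "int \<Rightarrow> nat list \<Rightarrow> nat" where
  "ind t a = (if a = [] \<or> t > int (sum_list a) then 0
              else Min {j \<in> {1..length a}. int (sum_list (take j a)) \<ge> t})"

(* The sums in the statement range over finite sets, so they are genuine sums. *)
lemma finite_compositions: "finite (compositions s m)"
proof (rule finite_subset)
  show "compositions s m \<subseteq> {a. set a \<subseteq> {..m} \<and> length a = s}"
    by (auto simp: compositions_def member_le_sum_list)
  show "finite {a. set a \<subseteq> {..m} \<and> length a = s}"
    by (rule finite_lists_length_eq) simp
qed

lemma finite_tuples_below: "finite (tuples_below d)"
proof (rule finite_subset)
  show "tuples_below d \<subseteq> {r. set r \<subseteq> {..sum_list d} \<and> length r = length d}"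
  proof (clarsimp simp: tuples_below_def list_all2_conv_all_nth in_set_conv_nth)
    fix r :: "nat list" and i
    assume "\<forall>i<length d. r ! i \<le> d ! i" "i < length d"
    then show "r ! i \<le> sum_list d"
      by (meson elem_le_sum_list le_trans)
  qed
  show "finite {r. set r \<subseteq> {..sum_list d} \<and> length r = length d}"
    by (rule finite_lists_length_eq) simp
qed

end

theory Submission
  imports Defs
begin

text \<open>
  The inner sum depends on \<open>k = |r|\<close> only and equals the sum of
  \<open>(n - 1 choose c) * (k choose |b| - 1 - c)\<close> over
  \<open>b\<^sub>1 + \<dots> + b\<^sub>j\<^sub>-\<^sub>1 \<le> c < b\<^sub>1 + \<dots> + b\<^sub>j\<close>. The alternating sum over \<open>r\<close> is the
  \<open>|d|\<close>-th finite difference in \<open>k\<close> at \<open>0\<close>, which keeps only \<open>c = |b| - |d| - 1\<close>; this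
  \<open>c\<close> lies in the range exactly when \<open>j\<close> is the index of \<open>|b| - |d|\<close> in \<open>b\<close>.
\<close>

text \<open>Both sides count the subsets of \<open>{0..<N}\<close> with \<open>p + q + 1\<close>
  elements, the left one according to the element \<open>i\<close> that has \<open>p\<close> chosen
  elements below it and \<open>q\<close> above it. The induction on \<open>N\<close> replaces this
  count by Pascal's rule in the second factor, hence \<open>q\<close> varies.\<close>

lemma sum_choose_convolution:
  "(\<Sum>i<N. (i choose p) * ((N - 1 - i) choose q)) = N choose (p + q + 1)"
proof (induction N arbitrary: q)
  case 0
  show ?case by simp
next
  case (Suc N)
  show ?case
  proof (cases q)
    case 0
    then show ?thesis
      using Suc.IH[of 0] by simp
  next
    case (Suc q')
    have "(\<Sum>i<Suc N. (i choose p) * ((Suc N - 1 - i) choose q))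
        = (\<Sum>i<N. (i choose p) * ((N - i) choose Suc q'))"
      using Suc by simp
    also have "\<dots> = (\<Sum>i<N. (i choose p) * ((N - 1 - i) choose q')
                          + (i choose p) * ((N - 1 - i) choose Suc q'))"
    proof (rule sum.cong[OF refl])
      fix i assume "i \<in> {..<N}"
      then have "N - i = Suc (N - 1 - i)" by simp
      then show "(i choose p) * ((N - i) choose Suc q')
          = (i choose p) * ((N - 1 - i) choose q') + (i choose p) * ((N - 1 - i) choose Suc q')"
        by (simp only: binomial_Suc_Suc distrib_left)
    qed
    also have "\<dots> = Suc N choose (p + q + 1)"
      using Suc.IH[of q'] Suc.IH[of "Suc q'"] Suc by (simp add: sum.distrib)
    finally show ?thesis .
  qed
qed

section \<open>Splitting off the first entry of a tuple\<close>

lemma sum_compositions_Suc: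
  "(\<Sum>a\<in>{a \<in> compositions (Suc s) m. P a}. f a)
   = (\<Sum>x\<in>{1..m}. \<Sum>a\<in>{a \<in> compositions s (m - x). P (x # a)}. f (x # a))"
proof -
  have "(\<Sum>x\<in>{1..m}. \<Sum>a\<in>{a \<in> compositions s (m - x). P (x # a)}. f (x # a))
      = (\<Sum>(x, a)\<in>(SIGMA x:{1..m}. {a \<in> compositions s (m - x). P (x # a)}). f (x # a))"
    by (rule sum.Sigma) (simp_all add: finite_compositions)
  also have "\<dots> = (\<Sum>a\<in>{a \<in> compositions (Suc s) m. P a}. f a)"
    by (rule sum.reindex_bij_witness[where i = "\<lambda>a. (hd a, tl a)" and j = "\<lambda>(x, a). x # a"])
       (auto simp: compositions_def length_Suc_conv)
  finally show ?thesis by simp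
qed

lemma sum_tuples_below_Cons:
  "(\<Sum>r\<in>tuples_below (x # d). f r) = (\<Sum>y\<le>x. \<Sum>r\<in>tuples_below d. f (y # r))"
proof -
  have "(\<Sum>y\<le>x. \<Sum>r\<in>tuples_below d. f (y # r))
      = (\<Sum>(y, r)\<in>{..x} \<times> tuples_below d. f (y # r))"
    by (rule sum.cartesian_product)
  also have "\<dots> = (\<Sum>r\<in>tuples_below (x # d). f r)"
    by (rule sum.reindex_bij_witness[where i = "\<lambda>a. (hd a, tl a)" and j = "\<lambda>(x, a). x # a"])
       (auto simp: tuples_below_def list_all2_Cons2)
  finally show ?thesis by simp
qed

lemma tuple_binom_Cons:
  "tuple_binom (x # d) (y # r) = (x choose y) * tuple_binom d r"
  by (simp add: tuple_binom_def prod.lessThan_Suc_shift del: prod.lessThan_Suc)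

lemma tuple_pred_Cons: "tuple_pred (x # a) = (x - 1) # tuple_pred a"
  by (simp add: tuple_pred_def)

section \<open>Finite differences of binomial coefficients\<close>

lemma binom_int_Suc: "binom_int (Suc m) e = binom_int m e + binom_int m (e - 1)"
proof -
  consider "e < 0" | "e = 0" | "e > 0" by linarith
  then show ?thesis
  proof cases
    case 3
    then have "nat e = Suc (nat (e - 1))" by simp
    with 3 show ?thesis by (simp add: binom_int_def)
  qed (simp_all add: binom_int_def)
qed

text \<open>By Pascal's rule, a difference of order \<open>d + 1\<close> at 0 is a difference of
  order \<open>d\<close> of the forward difference of \<open>f\<close>.\<close>

lemma alternating_sum_choose_Suc:
  fixes f :: "nat \<Rightarrow> int"
  shows "(\<Sum>r\<le>Suc d. (-1) ^ (Suc d - r) * int (Suc d choose r) * f r)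
       = (\<Sum>r\<le>d. (-1) ^ (d - r) * int (d choose r) * (f (Suc r) - f r))"
proof -
  have A: "(\<Sum>r\<le>Suc d. (-1) ^ (Suc d - r) * int (Suc d choose r) * f r)
      = (-1) ^ Suc d * f 0
        + (\<Sum>r\<le>d. (-1) ^ (d - r) * int (d choose r) * f (Suc r))
        + (\<Sum>r\<le>d. (-1) ^ (d - r) * int (d choose Suc r) * f (Suc r))"
    by (simp add: sum.atMost_Suc_shift sum.distrib algebra_simps del: sum.atMost_Suc)
  \<comment> \<open>The same auxiliary sum is evaluated twice: its top term vanishes since
    \<open>d choose Suc d\<close> is 0, and shifting its index produces the last sum in
    \<open>A\<close>. Comparing the two eliminates that sum.\<close>
  have "(\<Sum>r\<le>Suc d. (-1) ^ (Suc d - r) * int (d choose r) * f r)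
      = - (\<Sum>r\<le>d. (-1) ^ (d - r) * int (d choose r) * f r)"
    by (simp add: sum_negf[symmetric] Suc_diff_le)
  moreover have "(\<Sum>r\<le>Suc d. (-1) ^ (Suc d - r) * int (d choose r) * f r)
      = (-1) ^ Suc d * f 0
        + (\<Sum>r\<le>d. (-1) ^ (d - r) * int (d choose Suc r) * f (Suc r))"
    by (simp add: sum.atMost_Suc_shift del: sum.atMost_Suc)
  ultimately show ?thesis
    using A by (simp add: sum_subtractf right_diff_distrib)
qed

text \<open>Each forward difference in the upper index lowers \<open>e\<close> by one. An integer
  \<open>e\<close> lets this continue below 0 without case distinctions.\<close>

lemma alternating_sum_binom_int:
  "(\<Sum>r\<le>d. (-1) ^ (d - r) * int (d choose r) * binom_int (m + r) e) = binom_int m (e - int d)"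
proof (induction d arbitrary: e)
  case 0
  show ?case by simp
next
  case (Suc d)
  have "(\<Sum>r\<le>Suc d. (-1) ^ (Suc d - r) * int (Suc d choose r) * binom_int (m + r) e)
      = (\<Sum>r\<le>d. (-1) ^ (d - r) * int (d choose r) * binom_int (m + r) (e - 1))"
    unfolding alternating_sum_choose_Suc by (simp add: binom_int_Suc)
  also have "\<dots> = binom_int m (e - int (Suc d))"
    unfolding Suc.IH by (simp add: algebra_simps)
  finally show ?case .
qed

text \<open>The differences are taken one coordinate at a time, and a coordinate \<open>x\<close> of
  \<open>d\<close> lowers \<open>e\<close> by \<open>x\<close>. The induction varies
  \<open>m\<close> because fixing the first entry \<open>y\<close> of \<open>r\<close> shifts the
  upper index to \<open>m + y\<close>.\<close>

lemma alternating_sum_tuple_binom: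
  "(\<Sum>r\<in>tuples_below d. (-1) ^ sum_list (map2 (-) d r) * int (tuple_binom d r)
      * binom_int (m + sum_list r) e)
   = binom_int m (e - int (sum_list d))"
proof (induction d arbitrary: m)
  case Nil
  show ?case by (simp add: tuples_below_def tuple_binom_def)
next
  case (Cons x d)
  have "(\<Sum>r\<in>tuples_below (x # d). (-1) ^ sum_list (map2 (-) (x # d) r)
          * int (tuple_binom (x # d) r) * binom_int (m + sum_list r) e)
      = (\<Sum>y\<le>x. (-1) ^ (x - y) * int (x choose y)
          * (\<Sum>r\<in>tuples_below d. (-1) ^ sum_list (map2 (-) d r) * int (tuple_binom d r)
               * binom_int ((m + y) + sum_list r) e))"
    unfolding sum_tuples_below_Cons
    by (simp add: tuple_binom_Cons power_add sum_distrib_left ac_simps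
        del: Nat.add_diff_assoc2)
  also have "\<dots> = binom_int m (e - int (sum_list d) - int x)"
    unfolding Cons.IH by (rule alternating_sum_binom_int)
  finally show ?case by (simp add: algebra_simps)
qed

section \<open>The index, and compositions cut at a given point\<close>

lemma ind_eq_iff:
  assumes "t > 0" "j < length a"
  shows "ind t a = Suc j \<longleftrightarrow> int (sum_list (take j a)) < t \<and> t \<le> int (sum_list (take (Suc j) a))"
proof -
  let ?S = "{i \<in> {1..length a}. int (sum_list (take i a)) \<ge> t}"
  have mono: "sum_list (take i a) \<le> sum_list (take i' a)" if "i \<le> i'" for i i'
  proof -
    have "take i' a = take i a @ take (i' - i) (drop i a)"
      using that by (metis le_add_diff_inverse take_add)
    then show ?thesis by simp
  qed
  show ?thesis
  proof
    assume L: "ind t a = Suc j"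
    then have ne: "a \<noteq> []" "t \<le> int (sum_list a)"
      by (auto simp: ind_def split: if_splits)
    then have S: "length a \<in> ?S" by (simp add: Suc_le_eq)
    from L ne have M: "Min ?S = Suc j" by (simp add: ind_def)
    with S have "Suc j \<in> ?S" using Min_in[of ?S] by fastforce
    moreover have "j \<notin> ?S"
    proof
      assume "j \<in> ?S"
      then have "Min ?S \<le> j" by (intro Min_le) auto
      with M show False by simp
    qed
    ultimately show "int (sum_list (take j a)) < t \<and> t \<le> int (sum_list (take (Suc j) a))"
      \<comment> \<open>For \<open>j = 0\<close> the position 0 lies outside the range of the
        minimum, and the strict inequality is \<open>t > 0\<close> instead.\<close>
      using assms by (cases j) auto
  next
    assume R: "int (sum_list (take j a)) < t \<and> t \<le> int (sum_list (take (Suc j) a))"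
    have "Min ?S = Suc j"
    proof (rule Min_eqI)
      fix i assume i: "i \<in> ?S"
      show "Suc j \<le> i"
      proof (rule ccontr)
        assume "\<not> Suc j \<le> i"
        then have "sum_list (take i a) \<le> sum_list (take j a)" by (intro mono) simp
        with i R show False by simp
      qed
    qed (use R assms in auto)
    moreover have "t \<le> int (sum_list a)"
      using R mono[of "Suc j" "length a"] assms by simp
    ultimately show "ind t a = Suc j"
      using assms by (auto simp: ind_def)
  qed
qed

text \<open>
  Encode a composition together with the choices counted by the binomial coefficients as a
  subset of an interval containing its last point, where part \<open>i\<close> contributes \<open>b ! i\<close> points
  including its own last one. The index \<open>c\<close> is the number of chosen points below \<open>n\<close>.
\<close>
lemma sum_compositions_cut:
  assumes "\<forall>x\<in>set b. 1 \<le> x" "1 \<le> n" "j < length b"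
  shows "(\<Sum>a\<in>{a \<in> compositions (length b) (n + k).
              sum_list (take j a) < n \<and> n \<le> sum_list (take (Suc j) a)}.
            tuple_binom (tuple_pred a) (tuple_pred b))
       = (\<Sum>c\<in>{sum_list (take j b)..<sum_list (take (Suc j) b)}.
            ((n - 1) choose c) * (k choose (sum_list b - 1 - c)))"
  using assms
proof (induction b arbitrary: j n k)
  case Nil
  then show ?case by simp
next
  case (Cons y b)
  have y: "1 \<le> y" and b: "\<forall>x\<in>set b. 1 \<le> x" using Cons.prems by auto
  let ?w = "\<lambda>a. tuple_binom (tuple_pred a) (tuple_pred b)"
  show ?case
  proof (cases j)
    \<comment> \<open>The first part \<open>x\<close> already reaches \<open>n\<close>, so the
      remaining parts are unrestricted; \<open>?T\<close> is their total weight.\<close>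
    case 0
    let ?T = "\<lambda>m. \<Sum>a\<in>compositions (length b) m. ?w a"
    have "(\<Sum>a\<in>{a \<in> compositions (length (y # b)) (n + k).
              sum_list (take j a) < n \<and> n \<le> sum_list (take (Suc j) a)}.
            tuple_binom (tuple_pred a) (tuple_pred (y # b)))
        = (\<Sum>x\<in>{1..n + k}. if n \<le> x then ((x - 1) choose (y - 1)) * ?T (n + k - x) else 0)"
      unfolding length_Cons sum_compositions_Suc
      using Cons.prems(2) 0
      by (intro sum.cong) (auto simp: tuple_binom_Cons tuple_pred_Cons sum_distrib_left)
    also have "\<dots> = (\<Sum>x\<in>{n..n + k}. ((x - 1) choose (y - 1)) * ?T (n + k - x))"
      using Cons.prems(2) by (intro sum.mono_neutral_cong_right) auto
    also have "\<dots> = (\<Sum>i\<le>k. ((n - 1 + i) choose (y - 1)) * ?T (k - i))"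
      using Cons.prems(2)
      by (intro sum.reindex_bij_witness[where i = "\<lambda>i. n + i" and j = "\<lambda>x. x - n"])
         (auto simp: add.commute)
    also have "\<dots> = (\<Sum>c<y. ((n - 1) choose c) * (k choose (y + sum_list b - 1 - c)))"
    \<comment> \<open>Empty \<open>b\<close> is separate because \<open>sum_list b - 1\<close> would
      truncate. Then \<open>x\<close> must be all of \<open>n + k\<close>, and Vandermonde's
      identity suffices.\<close>
    proof (cases "b = []")
      case True
      have T: "?T m = (if m = 0 then 1 else 0)" for m
      proof -
        have "compositions 0 m = (if m = 0 then {[]} else {})"
          by (auto simp: compositions_def)
        then show ?thesis using True by (simp add: tuple_binom_def tuple_pred_def)
      qed
      have "(\<Sum>i\<le>k. ((n - 1 + i) choose (y - 1)) * ?T (k - i)) = (n - 1 + k) choose (y - 1)"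
      proof -
        have "(\<Sum>i\<le>k. ((n - 1 + i) choose (y - 1)) * ?T (k - i))
            = (\<Sum>i\<in>{k}. ((n - 1 + i) choose (y - 1)) * ?T (k - i))"
          by (rule sum.mono_neutral_right) (auto simp: T)
        then show ?thesis by (simp add: T)
      qed
      also have "\<dots> = (\<Sum>c\<le>y - 1. ((n - 1) choose c) * (k choose (y - 1 - c)))"
        by (rule vandermonde[symmetric])
      also have "{..y - 1} = {..<y}" using y by auto
      finally show ?thesis using True by simp
    next
      case False
      have pos: "0 < sum_list b" using b False by (cases b) auto
      have T0: "?T 0 = 0"
      proof -
        have "compositions (length b) 0 = {}"
          using False by (auto simp: compositions_def length_Suc_conv neq_Nil_conv)
        then show ?thesis by simp
      qed
      have T: "?T (Suc m) = m choose (sum_list b - 1)" for m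
      proof -
        \<comment> \<open>Cutting at 1 in the first part is no restriction, so the induction
          hypothesis with \<open>n = 1\<close> evaluates the unrestricted total; the factor
          \<open>0 choose c\<close> leaves only \<open>c = 0\<close>.\<close>
        have "?T (Suc m) = (\<Sum>a\<in>{a \<in> compositions (length b) (1 + m).
              sum_list (take 0 a) < 1 \<and> 1 \<le> sum_list (take (Suc 0) a)}. ?w a)"
          using False by (intro sum.cong) (auto simp: compositions_def length_Suc_conv neq_Nil_conv Suc_le_eq)
        also have "\<dots> = (\<Sum>c\<in>{0..<sum_list (take (Suc 0) b)}.
                            (0 choose c) * (m choose (sum_list b - 1 - c)))"
          using Cons.IH[OF b, of 1 0 m] False by simp
        also have "\<dots> = (\<Sum>c\<in>{0}. (0 choose c) * (m choose (sum_list b - 1 - c)))"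
          using False b by (intro sum.mono_neutral_right) (auto simp: neq_Nil_conv Suc_le_eq)
        finally show ?thesis by simp
      qed
      have "(\<Sum>i\<le>k. ((n - 1 + i) choose (y - 1)) * ?T (k - i))
          = (\<Sum>i<k. ((n - 1 + i) choose (y - 1)) * ((k - 1 - i) choose (sum_list b - 1)))"
      proof -
        have "(\<Sum>i\<le>k. ((n - 1 + i) choose (y - 1)) * ?T (k - i))
            = (\<Sum>i<k. ((n - 1 + i) choose (y - 1)) * ?T (k - i))"
          by (rule sum.mono_neutral_right) (auto simp: T0 not_less)
        also have "\<dots> = (\<Sum>i<k. ((n - 1 + i) choose (y - 1)) * ((k - 1 - i) choose (sum_list b - 1)))"
        proof (rule sum.cong[OF refl])
          fix i assume "i \<in> {..<k}"
          then have "k - i = Suc (k - 1 - i)" by simp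
          then show "((n - 1 + i) choose (y - 1)) * ?T (k - i)
              = ((n - 1 + i) choose (y - 1)) * ((k - 1 - i) choose (sum_list b - 1))"
            by (simp only: T)
        qed
        finally show ?thesis .
      qed
      \<comment> \<open>The \<open>y - 1\<close> points are split into \<open>c\<close> among the
        first \<open>n - 1\<close> places and the rest among the following \<open>i\<close>; the sum
        over \<open>i\<close> is then a convolution.\<close>
      also have "\<dots> = (\<Sum>i<k. \<Sum>c\<le>y - 1. ((n - 1) choose c) * ((i choose (y - 1 - c))
                          * ((k - 1 - i) choose (sum_list b - 1))))"
        by (simp add: vandermonde[symmetric] sum_distrib_right mult.assoc)
      also have "\<dots> = (\<Sum>c\<le>y - 1. ((n - 1) choose c) * (\<Sum>i<k. (i choose (y - 1 - c))
                          * ((k - 1 - i) choose (sum_list b - 1))))"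
        by (subst sum.swap) (simp only: sum_distrib_left)
      also have "\<dots> = (\<Sum>c<y. ((n - 1) choose c) * (k choose (y + sum_list b - 1 - c)))"
      proof (rule sum.cong)
        show "{..y - 1} = {..<y}" using y by auto
        fix c assume "c \<in> {..<y}"
        then have "y - 1 - c + (sum_list b - 1) + 1 = y + sum_list b - 1 - c"
          using pos by simp
        then show "((n - 1) choose c) * (\<Sum>i<k. (i choose (y - 1 - c))
                          * ((k - 1 - i) choose (sum_list b - 1)))
            = ((n - 1) choose c) * (k choose (y + sum_list b - 1 - c))"
          by (simp only: sum_choose_convolution)
      qed
      finally show ?thesis .
    qed
    finally show ?thesis using 0 by (simp add: atLeast0LessThan)
  next
    \<comment> \<open>The first part \<open>x\<close> ends before \<open>n\<close>, so the remaining
      parts are cut at \<open>n - x\<close>, with the same excess \<open>k\<close>.\<close>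
    case (Suc i)
    let ?I = "{sum_list (take i b)..<sum_list (take (Suc i) b)}"
    have i: "i < length b" using Suc Cons.prems by simp
    have "(\<Sum>a\<in>{a \<in> compositions (length (y # b)) (n + k).
              sum_list (take j a) < n \<and> n \<le> sum_list (take (Suc j) a)}.
            tuple_binom (tuple_pred a) (tuple_pred (y # b)))
        = (\<Sum>x\<in>{1..n + k}. \<Sum>a\<in>{a \<in> compositions (length b) (n + k - x).
              x + sum_list (take i a) < n \<and> n \<le> x + sum_list (take (Suc i) a)}.
             ((x - 1) choose (y - 1)) * ?w a)"
      unfolding length_Cons sum_compositions_Suc
      using Suc by (simp add: tuple_binom_Cons tuple_pred_Cons)
    also have "\<dots> = (\<Sum>x\<in>{1..<n}. \<Sum>a\<in>{a \<in> compositions (length b) (n + k - x).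
              x + sum_list (take i a) < n \<and> n \<le> x + sum_list (take (Suc i) a)}.
             ((x - 1) choose (y - 1)) * ?w a)"
      by (intro sum.mono_neutral_right) (auto intro!: sum.neutral)
    also have "\<dots> = (\<Sum>x\<in>{1..<n}. ((x - 1) choose (y - 1)) *
             (\<Sum>c\<in>?I. ((n - x - 1) choose c) * (k choose (sum_list b - 1 - c))))"
    proof (rule sum.cong[OF refl])
      fix x assume x: "x \<in> {1..<n}"
      then have "{a \<in> compositions (length b) (n + k - x).
              x + sum_list (take i a) < n \<and> n \<le> x + sum_list (take (Suc i) a)}
          = {a \<in> compositions (length b) (n - x + k).
              sum_list (take i a) < n - x \<and> n - x \<le> sum_list (take (Suc i) a)}"
        by (intro Collect_cong) (auto simp: less_diff_conv le_diff_conv add.commute)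
      moreover have "1 \<le> n - x" using x by auto
      ultimately show "(\<Sum>a\<in>{a \<in> compositions (length b) (n + k - x).
              x + sum_list (take i a) < n \<and> n \<le> x + sum_list (take (Suc i) a)}.
             ((x - 1) choose (y - 1)) * ?w a)
          = ((x - 1) choose (y - 1)) *
             (\<Sum>c\<in>?I. ((n - x - 1) choose c) * (k choose (sum_list b - 1 - c)))"
        by (simp only: Cons.IH[OF b _ i] flip: sum_distrib_left)
    qed
    also have "\<dots> = (\<Sum>x<n - 1. (x choose (y - 1)) *
             (\<Sum>c\<in>?I. ((n - 1 - 1 - x) choose c) * (k choose (sum_list b - 1 - c))))"
      by (intro sum.reindex_bij_witness[where i = Suc and j = "\<lambda>x. x - 1"]) auto
    also have "\<dots> = (\<Sum>c\<in>?I. (\<Sum>x<n - 1. (x choose (y - 1)) * ((n - 1 - 1 - x) choose c))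
                          * (k choose (sum_list b - 1 - c)))"
      unfolding sum_distrib_left sum_distrib_right by (subst sum.swap) (simp only: mult.assoc)
    \<comment> \<open>The convolution adds to the \<open>c\<close> points of the later parts the
      \<open>y - 1\<close> inner points of the first part and its last one, \<open>y + c\<close> in
      all; \<open>y\<close> is at least 1.\<close>
    also have "\<dots> = (\<Sum>c\<in>?I. ((n - 1) choose (y + c)) * (k choose (sum_list b - 1 - c)))"
      using y by (simp only: sum_choose_convolution) (simp add: add.commute)
    also have "\<dots> = (\<Sum>c\<in>{y + sum_list (take i b)..<y + sum_list (take (Suc i) b)}.
                 ((n - 1) choose c) * (k choose (y + sum_list b - 1 - c)))"
      using y by (intro sum.reindex_bij_witness[where j = "\<lambda>c. y + c" and i = "\<lambda>c. c - y"]) auto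
    finally show ?thesis using Suc by simp
  qed
qed

section \<open>Assembling the identity\<close>

theorem theoremA3:
  fixes d b :: "nat list" and l s n j :: nat
  assumes "length d = l"
    and "length b = s" and "\<forall>x\<in>set b. 1 \<le> x"
    and "1 \<le> n"
    and "1 \<le> j" and "j \<le> s"
  shows "(\<Sum>r\<in>tuples_below d. (-1) ^ sum_list (map2 (-) d r) * int (tuple_binom d r) *
            (\<Sum>a\<in>{a \<in> compositions s (n + sum_list r). ind (int n) a = j}.
               int (tuple_binom (tuple_pred a) (tuple_pred b))))
         = (if j = ind (int (sum_list b) - int (sum_list d)) b
            then binom_int (n - 1) (int (sum_list b) - int (sum_list d) - 1)
            else 0)"
proof -
  obtain i where j: "j = Suc i" and i: "i < length b"
    using assms by (cases j) auto
  let ?I = "{sum_list (take i b)..<sum_list (take (Suc i) b)}"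
  let ?t = "int (sum_list b) - int (sum_list d)"
  let ?sgn = "\<lambda>r. (-1) ^ sum_list (map2 (-) d r) * int (tuple_binom d r)"
  \<comment> \<open>This keeps \<open>sum_list b - 1 - c\<close> from truncating, so that it agrees
    with the integer lower index of \<open>binom_int\<close>.\<close>
  have I: "c < sum_list b" if "c \<in> ?I" for c
  proof -
    have "sum_list (take (Suc i) b) \<le> sum_list (take (Suc i) b @ drop (Suc i) b)"
      unfolding sum_list_append by simp
    with that show ?thesis by simp
  qed
  have inner: "(\<Sum>a\<in>{a \<in> compositions s (n + k). ind (int n) a = j}.
               int (tuple_binom (tuple_pred a) (tuple_pred b)))
      = (\<Sum>c\<in>?I. int ((n - 1) choose c) * binom_int k (int (sum_list b) - 1 - int c))" for k
  proof -
    have "{a \<in> compositions s (n + k). ind (int n) a = j}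
        = {a \<in> compositions (length b) (n + k).
              sum_list (take i a) < n \<and> n \<le> sum_list (take (Suc i) a)}"
      using assms i by (auto simp: j ind_eq_iff compositions_def)
    then have "(\<Sum>a\<in>{a \<in> compositions s (n + k). ind (int n) a = j}.
               int (tuple_binom (tuple_pred a) (tuple_pred b)))
        = int (\<Sum>c\<in>?I. ((n - 1) choose c) * (k choose (sum_list b - 1 - c)))"
      using sum_compositions_cut[OF assms(3,4) i, of k] by (simp flip: of_nat_sum)
    also have "\<dots> = (\<Sum>c\<in>?I. int ((n - 1) choose c) * binom_int k (int (sum_list b) - 1 - int c))"
      unfolding of_nat_sum
    proof (rule sum.cong[OF refl])
      fix c assume "c \<in> ?I"
      then have "c < sum_list b" by (rule I)
      then have "int (sum_list b) - 1 - int c = int (sum_list b - 1 - c)" by simp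
      then show "int (((n - 1) choose c) * (k choose (sum_list b - 1 - c)))
          = int ((n - 1) choose c) * binom_int k (int (sum_list b) - 1 - int c)"
        unfolding binom_int_def by (simp only: nat_int of_nat_mult) simp
    qed
    finally show ?thesis .
  qed
  \<comment> \<open>Only the factor with upper index \<open>sum_list r\<close> depends on
    \<open>r\<close>, so the difference lemma applies with \<open>m = 0\<close>.\<close>
  have "(\<Sum>r\<in>tuples_below d. ?sgn r *
            (\<Sum>a\<in>{a \<in> compositions s (n + sum_list r). ind (int n) a = j}.
               int (tuple_binom (tuple_pred a) (tuple_pred b))))
      = (\<Sum>c\<in>?I. int ((n - 1) choose c) * (\<Sum>r\<in>tuples_below d. ?sgn r *
            binom_int (0 + sum_list r) (int (sum_list b) - 1 - int c)))"
    unfolding inner sum_distrib_left by (subst sum.swap) (simp add: ac_simps)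
  also have "\<dots> = (\<Sum>c\<in>?I. int ((n - 1) choose c) * binom_int 0 (?t - 1 - int c))"
    unfolding alternating_sum_tuple_binom by (simp add: algebra_simps)
  \<comment> \<open>With upper index 0 the coefficient is 1 at lower index 0 and 0 elsewhere, which
    selects a single \<open>c\<close>.\<close>
  also have "\<dots> = (\<Sum>c\<in>?I. if int c = ?t - 1 then int ((n - 1) choose c) else 0)"
    by (intro sum.cong) (auto simp: binom_int_def)
  also have "\<dots> = (if j = ind ?t b then binom_int (n - 1) (?t - 1) else 0)"
  proof (cases "?t > 0")
    case True
    define c where "c = nat (?t - 1)"
    have c: "?t = int c + 1" using True by (simp add: c_def)
    have "(\<Sum>c\<in>?I. if int c = ?t - 1 then int ((n - 1) choose c) else 0)
        = (if c \<in> ?I then int ((n - 1) choose c) else 0)"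
      unfolding c by (simp add: sum.delta')
    \<comment> \<open>Since \<open>c\<close> is \<open>?t - 1\<close>, the half-open range for
      \<open>c\<close> turns into the strict lower and weak upper bound on \<open>?t\<close> that
      characterise the index.\<close>
    moreover have "c \<in> ?I \<longleftrightarrow> j = ind ?t b"
      unfolding j eq_commute[of "Suc i"] ind_eq_iff[OF True i] unfolding c by auto
    moreover have "binom_int (n - 1) (?t - 1) = int ((n - 1) choose c)"
      unfolding c by (simp add: binom_int_def)
    ultimately show ?thesis by simp
  next
    \<comment> \<open>Now \<open>?t - 1\<close> is negative: no \<open>c\<close> matches it, and
      \<open>binom_int\<close> is 0 there, even if \<open>j\<close> equals the index (which is then
      1 for nonempty \<open>b\<close>).\<close>
    case False
    then show ?thesis by (auto simp: binom_int_def intro!: sum.neutral)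
  qed
  finally show ?thesis .
qed

end
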